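(* Let $\mathcal{E}=\{p_\lambda : \lambda\in\Lambda\}$ be a full regular and steep exponential family of densities on $(\mathcal{X},\mathcal{F},\mu)$ with source parameter $\lambda\in\Lambda$, natural parameter space $\Theta\subset\mathbb{R}^D$, and bijective ordinary-to-natural parameter conversion function $\theta:\Lambda\to\Theta$. For all $\lambda_1,\lambda_2\in\Lambda$, put $$M_\theta(\lambda_1,\lambda_2):=\theta^{-1}\left(\frac{\theta(\lambda_1)+\theta(\lambda_2)}{2}\right).$$ Then, for every $\omega\in\mathcal{X}$, $$\rho[p_{\lambda_1},p_{\lambda_2}]=\frac{\sqrt{p_{\lambda_1}(\omega)\,p_{\lambda_2}(\omega)}}{p_{M_\theta(\lambda_1,\lambda_2)}(\omega)},\qquad D_B[p_{\lambda_1},p_{\lambda_2}]=\log\left(\frac{p_{M_\theta(\lambda_1,\lambda_2)}(\omega)}{\sqrt{p_{\lambda_1}(\omega)\,p_{\lambda_2}(\omega)}}\right),$$ $$D_H[p_{\lambda_1},p_{\lambda_2}]=\sqrt{1-\frac{\sqrt{p_{\lambda_1}(\omega)\,p_{\lambda_2}(\omega)}}{p_{M_\theta(\lambda_1,\lambda_2)}(\omega)}}.$$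
   Context: $(\mathcal{X},\mathcal{F},\mu)$ is a measure space with positive measure $\mu$. An exponential family of order $D$ with source parameter $\lambda\in\Lambda$ has densities with respect to $\mu$ $$p_\lambda(x)=\exp\left(\theta(\lambda)^\top t(x)-F(\theta(\lambda))+k(x)\right),\quad x\in\mathcal{X},$$ where $t:\mathcal{X}\to\mathbb{R}^D$ is the (minimal) sufficient statistic, $k:\mathcal{X}\to\mathbb{R}$ is the carrier term, $\theta:\Lambda\to\Theta$ is a bijection (with inverse $\theta^{-1}$), and $F(\theta)=\log\int_{\mathcal{X}}\exp(\theta^\top t(x)+k(x))\,\mathrm{d}\mu(x)$ is the cumulant function. Full regular means that $\Theta$ is the set of all $\theta\in\mathbb{R}^D$ for which this integral is finite, and that it is a non-empty open convex set. Steep means that $\{E_{p_\lambda}[t(x)]:\lambda\in\Lambda\}$ equals the interior of the closed convex hull of $\{t(x):x\in\mathcal{X}\}$. All densities of the family have the same support $\mathcal{X}$ (they are strictly positive at every point of $\mathcal{X}$). For densities $p,q$: the Bhattacharyya coefficient is $\rho[p,q]=\int_{\mathcal{X}}\sqrt{p(x)q(x)}\,\mathrm{d}\mu(x)$, the Bhattacharyya distance is $D_B[p,q]=-\log\rho[p,q]$, and the Hellinger distance is $D_H[p,q]=\sqrt{1-\rho[p,q]}$. *)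

theory Defs
  imports "HOL-Analysis.Analysis"
begin

text \<open>
  The sample space is \<^term>\<open>space M\<close> for an arbitrary measure \<^term>\<open>M\<close>. As the integrand is
  nonnegative, finiteness of the normalising integral is integrability.
\<close>

definition natural_parameter_space ::
  "'x measure \<Rightarrow> ('x \<Rightarrow> real ^ 'd) \<Rightarrow> ('x \<Rightarrow> real) \<Rightarrow> (real ^ 'd) set"
  where "natural_parameter_space M t k = {\<eta>. integrable M (\<lambda>x. exp (\<eta> \<bullet> t x + k x))}"

definition cumulant ::
  "'x measure \<Rightarrow> ('x \<Rightarrow> real ^ 'd) \<Rightarrow> ('x \<Rightarrow> real) \<Rightarrow> real ^ 'd \<Rightarrow> real"
  where "cumulant M t k \<eta> = ln (LINT x|M. exp (\<eta> \<bullet> t x + k x))"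

definition exp_density ::
  "'x measure \<Rightarrow> ('x \<Rightarrow> real ^ 'd) \<Rightarrow> ('x \<Rightarrow> real) \<Rightarrow> ('l \<Rightarrow> real ^ 'd) \<Rightarrow> 'l \<Rightarrow> 'x \<Rightarrow> real"
  where "exp_density M t k \<theta> l x = exp (\<theta> l \<bullet> t x - cumulant M t k (\<theta> l) + k x)"

text \<open>
  Minimality of the statistic (the family really has order \<open>D\<close>): the functions
  \<open>1, t\<^sub>1, \<dots>, t\<^sub>D\<close> are linearly independent modulo null sets. It excludes the zero measure,
  for which \<^const>\<open>cumulant\<close> would be the junk value \<^term>\<open>ln 0\<close>.
\<close>

definition minimal_statistic :: "'x measure \<Rightarrow> ('x \<Rightarrow> real ^ 'd) \<Rightarrow> bool"
  where "minimal_statistic M t \<longleftrightarrow> (\<forall>a b. a \<noteq> 0 \<longrightarrow> \<not> (AE x in M. a \<bullet> t x = b))"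

locale exponential_family =
  fixes M :: "'x measure"
    and t :: "'x \<Rightarrow> real ^ 'd"
    and k :: "'x \<Rightarrow> real"
    and \<Lambda> :: "'l set"
    and \<Theta> :: "(real ^ 'd) set"
    and \<theta> :: "'l \<Rightarrow> real ^ 'd"
  assumes measurable_statistic: "t \<in> borel_measurable M"
    and measurable_carrier: "k \<in> borel_measurable M"
    and minimal: "minimal_statistic M t"
    and bij_parameter: "bij_betw \<theta> \<Lambda> \<Theta>"
    and normalisable: "\<Theta> \<subseteq> natural_parameter_space M t k"

definition full_regular ::
  "'x measure \<Rightarrow> ('x \<Rightarrow> real ^ 'd) \<Rightarrow> ('x \<Rightarrow> real) \<Rightarrow> (real ^ 'd) set \<Rightarrow> bool"
  where "full_regular M t k \<Theta> \<longleftrightarrow>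
    \<Theta> = natural_parameter_space M t k \<and> \<Theta> \<noteq> {} \<and> open \<Theta> \<and> convex \<Theta>"

definition mean_statistic ::
  "'x measure \<Rightarrow> ('x \<Rightarrow> real ^ 'd) \<Rightarrow> ('x \<Rightarrow> real) \<Rightarrow> ('l \<Rightarrow> real ^ 'd) \<Rightarrow> 'l \<Rightarrow> real ^ 'd"
  where "mean_statistic M t k \<theta> l = (LINT x|density M (\<lambda>x. ennreal (exp_density M t k \<theta> l x)). t x)"

definition steep ::
  "'x measure \<Rightarrow> ('x \<Rightarrow> real ^ 'd) \<Rightarrow> ('x \<Rightarrow> real) \<Rightarrow> 'l set \<Rightarrow> ('l \<Rightarrow> real ^ 'd) \<Rightarrow> bool"
  where "steep M t k \<Lambda> \<theta> \<longleftrightarrow>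
    mean_statistic M t k \<theta> ` \<Lambda> = interior (closure (convex hull (t ` space M)))"

definition bhattacharyya_coeff :: "'x measure \<Rightarrow> ('x \<Rightarrow> real) \<Rightarrow> ('x \<Rightarrow> real) \<Rightarrow> real"
  where "bhattacharyya_coeff M p q = (LINT x|M. sqrt (p x * q x))"

definition bhattacharyya_dist :: "'x measure \<Rightarrow> ('x \<Rightarrow> real) \<Rightarrow> ('x \<Rightarrow> real) \<Rightarrow> real"
  where "bhattacharyya_dist M p q = - ln (bhattacharyya_coeff M p q)"

definition hellinger_dist :: "'x measure \<Rightarrow> ('x \<Rightarrow> real) \<Rightarrow> ('x \<Rightarrow> real) \<Rightarrow> real"
  where "hellinger_dist M p q = sqrt (1 - bhattacharyya_coeff M p q)"

definition quasi_arithmetic_mean :: "'l set \<Rightarrow> ('l \<Rightarrow> real ^ 'd) \<Rightarrow> 'l \<Rightarrow> 'l \<Rightarrow> 'l"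
  where "quasi_arithmetic_mean \<Lambda> \<theta> l1 l2 = inv_into \<Lambda> \<theta> ((\<theta> l1 + \<theta> l2) /\<^sub>R 2)"

end

theory Submission
  imports Defs
begin

text \<open>
  The square root of a product of two densities of the family is the exponential of the average
  of their exponents. The average of the natural parameters is again a natural parameter, by
  convexity of \<open>\<Theta>\<close>, so this exponential is, up to a factor that does not depend on the
  sample point, the density of the quasi-arithmetic mean \<open>m\<close>:
  \<open>sqrt (p\<^sub>1 x * p\<^sub>2 x) = exp (F (\<theta> m) - (F (\<theta> l1) + F (\<theta> l2)) / 2) * p\<^sub>m x\<close>
  (\<open>sqrt_exp_density_mult\<close>). Integrating over \<open>x\<close>, where \<open>p\<^sub>m\<close> integrates to 1
  (\<open>integral_exp_density\<close>), shows that the factor is the Bhattacharyya coefficient;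
  evaluating the identity at a single \<open>\<omega>\<close> instead
  shows that it is the quotient \<open>sqrt (p\<^sub>1 \<omega> * p\<^sub>2 \<omega>) / p\<^sub>m \<omega>\<close>. Both
  distances are functions of that coefficient.
\<close>

lemma sqrt_exp_mult_exp: "sqrt (exp a * exp b) = exp ((a + b) / 2)" for a b :: real
  by (rule real_sqrt_unique) (simp_all add: power2_eq_square flip: exp_add)

lemma exp_density_pos: "exp_density M t k \<theta> l x > 0"
  by (simp add: exp_density_def)

lemma sqrt_exp_density_mult:
  assumes "\<theta> m = (\<theta> l1 + \<theta> l2) /\<^sub>R 2"
  shows "sqrt (exp_density M t k \<theta> l1 x * exp_density M t k \<theta> l2 x) =
    exp (cumulant M t k (\<theta> m) - (cumulant M t k (\<theta> l1) + cumulant M t k (\<theta> l2)) / 2)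
      * exp_density M t k \<theta> m x"
proof -
  have "\<theta> m \<bullet> t x = (\<theta> l1 \<bullet> t x + \<theta> l2 \<bullet> t x) / 2"
    by (simp add: assms inner_add_left)
  then show ?thesis
    unfolding exp_density_def sqrt_exp_mult_exp unfolding exp_add[symmetric]
    by (intro arg_cong[where f = exp]) (simp add: field_simps)
qed

lemma minimal_statistic_not_AE_False:
  fixes t :: "'x \<Rightarrow> real ^ 'd"
  assumes "minimal_statistic M t"
  shows "\<not> (AE x in M. False)"
proof
  assume "AE x in M. False"
  then have "AE x in M. 1 \<bullet> t x = 0"
    by eventually_elim simp
  moreover have "(1 :: real ^ 'd) \<noteq> 0"
    by simp
  ultimately show False
    using assms unfolding minimal_statistic_def by blast
qed

context exponential_family
begin

text \<open>
  The integrand is strictly positive, so its integral could vanish only over a null measure, which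
  minimality excludes. Hence \<^const>\<open>cumulant\<close> is a genuine logarithm.
\<close>

lemma exp_cumulant:
  assumes "\<eta> \<in> \<Theta>"
  shows "exp (cumulant M t k \<eta>) = (LINT x|M. exp (\<eta> \<bullet> t x + k x))"
proof -
  let ?f = "\<lambda>x. exp (\<eta> \<bullet> t x + k x)"
  have int: "integrable M ?f"
    using assms normalisable by (auto simp: natural_parameter_space_def)
  have "(LINT x|M. ?f x) \<noteq> 0"
    using integral_nonneg_eq_0_iff_AE[OF int] minimal_statistic_not_AE_False[OF minimal] by simp
  moreover have "(LINT x|M. ?f x) \<ge> 0"
    by (rule integral_nonneg_AE) simp
  ultimately show ?thesis
    by (simp add: cumulant_def order_less_le)
qed

lemma integral_exp_density:
  assumes "l \<in> \<Lambda>"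
  shows "(LINT x|M. exp_density M t k \<theta> l x) = 1"
proof -
  have "\<theta> l \<in> \<Theta>"
    using assms bij_parameter by (rule bij_betwE[rule_format, rotated])
  moreover have "exp_density M t k \<theta> l x
      = exp (- cumulant M t k (\<theta> l)) * exp (\<theta> l \<bullet> t x + k x)" for x
    by (simp add: exp_density_def flip: exp_add)
  ultimately show ?thesis
    by (simp add: exp_cumulant[symmetric] exp_minus)
qed

lemma quasi_arithmetic_mean:
  assumes "convex \<Theta>" and "l1 \<in> \<Lambda>" and "l2 \<in> \<Lambda>"
  shows "quasi_arithmetic_mean \<Lambda> \<theta> l1 l2 \<in> \<Lambda>"
    and "\<theta> (quasi_arithmetic_mean \<Lambda> \<theta> l1 l2) = (\<theta> l1 + \<theta> l2) /\<^sub>R 2"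
proof -
  have im: "\<theta> ` \<Lambda> = \<Theta>"
    using bij_parameter by (rule bij_betw_imp_surj_on)
  have "(1/2) *\<^sub>R \<theta> l1 + (1/2) *\<^sub>R \<theta> l2 \<in> \<Theta>"
    using assms im by (intro convexD) auto
  then have "(\<theta> l1 + \<theta> l2) /\<^sub>R 2 \<in> \<theta> ` \<Lambda>"
    by (simp add: im scaleR_add_right)
  then show "quasi_arithmetic_mean \<Lambda> \<theta> l1 l2 \<in> \<Lambda>"
    and "\<theta> (quasi_arithmetic_mean \<Lambda> \<theta> l1 l2) = (\<theta> l1 + \<theta> l2) /\<^sub>R 2"
    unfolding quasi_arithmetic_mean_def by (rule inv_into_into, rule f_inv_into_f)
qed

text \<open>
  The quotient at \<open>x\<close> is the constant by which the geometric mean of the two densities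
  differs from the normalised density of their quasi-arithmetic mean.
\<close>

lemma bhattacharyya_coeff_exp_density:
  assumes "convex \<Theta>" and "l1 \<in> \<Lambda>" and "l2 \<in> \<Lambda>"
  shows "bhattacharyya_coeff M (exp_density M t k \<theta> l1) (exp_density M t k \<theta> l2) =
    sqrt (exp_density M t k \<theta> l1 x * exp_density M t k \<theta> l2 x)
      / exp_density M t k \<theta> (quasi_arithmetic_mean \<Lambda> \<theta> l1 l2) x"
proof -
  note mean = quasi_arithmetic_mean[OF assms]
  note factor = sqrt_exp_density_mult[of \<theta>, OF mean(2), where M = M and t = t and k = k]
  show ?thesis
    using exp_density_pos[of M t k \<theta> "quasi_arithmetic_mean \<Lambda> \<theta> l1 l2" x]
    by (simp add: bhattacharyya_coeff_def factor integral_exp_density[OF mean(1)])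
qed

end

theorem mainTheorem1:
  fixes M :: "'x measure"
    and t :: "'x \<Rightarrow> real ^ 'd"
    and k :: "'x \<Rightarrow> real"
    and \<Lambda> :: "'l set"
    and \<Theta> :: "(real ^ 'd) set"
    and \<theta> :: "'l \<Rightarrow> real ^ 'd"
    and l1 l2 :: 'l
    and \<omega> :: 'x
  assumes "exponential_family M t k \<Lambda> \<Theta> \<theta>"
    and "full_regular M t k \<Theta>"
    and "steep M t k \<Lambda> \<theta>"
    and "l1 \<in> \<Lambda>" and "l2 \<in> \<Lambda>" and "\<omega> \<in> space M"
  shows "let p = exp_density M t k \<theta>; m = quasi_arithmetic_mean \<Lambda> \<theta> l1 l2 in
           bhattacharyya_coeff M (p l1) (p l2) = sqrt (p l1 \<omega> * p l2 \<omega>) / p m \<omega> \<and>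
           bhattacharyya_dist M (p l1) (p l2) = ln (p m \<omega> / sqrt (p l1 \<omega> * p l2 \<omega>)) \<and>
           hellinger_dist M (p l1) (p l2) = sqrt (1 - sqrt (p l1 \<omega> * p l2 \<omega>) / p m \<omega>)"
proof -
  interpret exponential_family M t k \<Lambda> \<Theta> \<theta>
    by fact
  have "convex \<Theta>"
    using assms(2) unfolding full_regular_def by blast
  note coeff = bhattacharyya_coeff_exp_density[OF this assms(4,5), of \<omega>]
  have "- ln (a / b) = ln (b / a)" for a b :: real
    by (simp flip: ln_inverse)
  then show ?thesis
    unfolding Let_def bhattacharyya_dist_def hellinger_dist_def coeff by simp
qed

end
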